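(* Let $S:\mathbb{R}\rightarrow\mathbb{R}$ be a sublinear function, i.e. $S$ is subadditive and $S(nx)=nS(x)$ for all $x\in\mathbb{R}$ and $n=0,1,2,\dots$. If $S$ is locally bounded, then both $S|\mathbb{R}_{+}$ and $S|\mathbb{R}_{-}$ are linear.
   Context: $S$ is subadditive if $S(x+y)\le S(x)+S(y)$ for all $x,y\in\mathbb{R}$. Locally bounded means bounded on some neighbourhood of each point. $\mathbb{R}_{+}=[0,\infty)$, $\mathbb{R}_{-}=(-\infty,0]$; a function on $D\subseteq\mathbb{R}$ is linear if it has the form $x\mapsto cx$ on $D$ for some $c\in\mathbb{R}$ (the constants for $\mathbb{R}_{+}$ and $\mathbb{R}_{-}$ may differ). *)

theory Defs
  imports "HOL-Analysis.Analysis"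
begin

definition subadditive_fun :: "(real \<Rightarrow> real) \<Rightarrow> bool" where
  "subadditive_fun S \<longleftrightarrow> (\<forall>x y. S (x + y) \<le> S x + S y)"

(* Only N-homogeneity is required, not positive real homogeneity as in the usual functional-analytic notion. *)
definition sublinear_fun :: "(real \<Rightarrow> real) \<Rightarrow> bool" where
  "sublinear_fun S \<longleftrightarrow>
     subadditive_fun S \<and> (\<forall>(x::real) (n::nat). S (real n * x) = real n * S x)"

definition locally_bounded_fun :: "(real \<Rightarrow> real) \<Rightarrow> bool" where
  "locally_bounded_fun S \<longleftrightarrow> (\<forall>x. \<exists>U. open U \<and> x \<in> U \<and> bounded (S ` U))"

definition linear_fun_on :: "real set \<Rightarrow> (real \<Rightarrow> real) \<Rightarrow> bool" where
  "linear_fun_on D f \<longleftrightarrow> (\<exists>c. \<forall>x\<in>D. f x = c * x)"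

end

(* Local boundedness at 0 and homogeneity bound S on [-1, 1] by some B. For t >= 0 and e = 1 or e = -1, write
   n t = k + f with k = floor (n t) and 0 <= f < 1. Subadditivity shows that n S(t e) = S(k e + f e) differs from
   k S(e) by at most B, so n |S(t e) - t S(e)| is bounded uniformly in n, hence S(t e) = t S(e). *)
theory Submission
  imports Defs
begin

lemma sublinear_fun_scale:
  "sublinear_fun S \<Longrightarrow> S (real n * x) = real n * S x"
  by (simp add: sublinear_fun_def)

text \<open>Subadditivity gives the upper estimate directly and the lower one from x = (x + h) +
  (-h). Since \<open>S\<close> need not be even, control at both \<open>h\<close> and
  \<open>-h\<close> is assumed.\<close>

lemma sublinear_fun_abs_diff_le:
  assumes "sublinear_fun S" and "\<bar>S h\<bar> \<le> B" and "\<bar>S (- h)\<bar> \<le> B"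
  shows "\<bar>S (x + h) - S x\<bar> \<le> B"
proof -
  have sub: "S (u + v) \<le> S u + S v" for u v
    using assms(1) by (simp add: sublinear_fun_def subadditive_fun_def)
  show ?thesis
    using sub[of x h] sub[of "x + h" "- h"] assms(2,3) by simp
qed

text \<open>Homogeneity spreads a bound near 0 to [-1, 1]: shrink x to x / n inside the
  neighbourhood, then multiply the value back by n.\<close>

lemma sublinear_fun_bounded_on_unit_interval:
  assumes S: "sublinear_fun S" and "locally_bounded_fun S"
  obtains B where "\<And>x. \<bar>x\<bar> \<le> 1 \<Longrightarrow> \<bar>S x\<bar> \<le> B"
proof -
  obtain U where "open U" "0 \<in> U" and bdd: "bounded (S ` U)"
    using assms(2) by (auto simp: locally_bounded_fun_def)
  then obtain d where d: "d > 0" "ball 0 d \<subseteq> U"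
    by (meson openE)
  obtain M where M: "\<And>x. x \<in> U \<Longrightarrow> \<bar>S x\<bar> \<le> M"
    using bdd by (auto simp: bounded_iff)
  \<comment> \<open>This \<open>n\<close> depends only on \<open>d\<close>, so the single bound
    \<open>real n * M\<close> serves all x in [-1, 1].\<close>
  obtain n :: nat where n: "n > 0" "1 / d < real n"
    using reals_Archimedean2[of "1 / d"] d(1)
    by (metis divide_pos_pos gr0I less_asym of_nat_0 zero_less_one)
  have "\<bar>S x\<bar> \<le> real n * M" if x: "\<bar>x\<bar> \<le> 1" for x
  proof -
    have "\<bar>x / real n\<bar> \<le> 1 / real n"
      using x n by (simp add: abs_divide divide_right_mono)
    also have "1 / real n < d"
      using n d(1) by (simp add: field_simps)
    finally have "\<bar>S (x / real n)\<bar> \<le> M"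
      using d(2) by (intro M) (auto simp: dist_real_def)
    moreover have "S x = real n * S (x / real n)"
      using sublinear_fun_scale[OF S, of n "x / real n"] n by simp
    ultimately show ?thesis
      using n by (simp add: abs_mult)
  qed
  then show thesis by (rule that)
qed

lemma eq_zero_if_multiples_bounded:
  fixes a :: real
  assumes "\<And>n::nat. real n * \<bar>a\<bar> \<le> C"
  shows "a = 0"
proof (rule ccontr)
  assume "a \<noteq> 0"
  then obtain n :: nat where "C < real n * \<bar>a\<bar>"
    using reals_Archimedean3[of "\<bar>a\<bar>"] by auto
  then show False
    using assms[of n] by simp
qed

text \<open>A general direction \<open>e\<close> treats both half-lines at once; |e| \<le> 1 keeps
  the remainder \<open>f * e\<close> inside [-1, 1].\<close>

lemma sublinear_fun_pos_homogeneous: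
  assumes S: "sublinear_fun S" and "locally_bounded_fun S"
    and e: "\<bar>e\<bar> \<le> 1" and t: "t \<ge> 0"
  shows "S (t * e) = t * S e"
proof -
  obtain B where B: "\<And>x. \<bar>x\<bar> \<le> 1 \<Longrightarrow> \<bar>S x\<bar> \<le> B"
    using sublinear_fun_bounded_on_unit_interval[OF assms(1,2)] by blast
  have "real n * \<bar>S (t * e) - t * S e\<bar> \<le> B + \<bar>S e\<bar>" for n :: nat
  proof -
    \<comment> \<open>Since t \<ge> 0, the floor is nonnegative and \<open>nat\<close> does not
      truncate it.\<close>
    define k where "k = nat \<lfloor>real n * t\<rfloor>"
    define f where "f = real n * t - real k"
    have f: "0 \<le> f" "f \<le> 1"
      using t unfolding f_def k_def by (simp_all, linarith+)
    have "\<bar>f * e\<bar> \<le> 1"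
      using f e by (simp add: abs_mult mult_le_one)
    then have "\<bar>S (real k * e + f * e) - S (real k * e)\<bar> \<le> B"
      using S B by (intro sublinear_fun_abs_diff_le) auto
    moreover have "real k * e + f * e = real n * (t * e)"
      by (simp add: f_def algebra_simps)
    ultimately have 1: "\<bar>real n * S (t * e) - real k * S e\<bar> \<le> B"
      by (simp add: sublinear_fun_scale[OF S])
    \<comment> \<open>This is the cost of replacing \<open>real k * S e\<close> by
      \<open>real n * t * S e\<close>; like \<open>B\<close>, it is independent of
      \<open>n\<close>.\<close>
    have 2: "\<bar>f * S e\<bar> \<le> \<bar>S e\<bar>"
      using f by (simp add: abs_mult mult_left_le_one_le)
    have "real n * (S (t * e) - t * S e) = (real n * S (t * e) - real k * S e) - f * S e"
      by (simp add: f_def algebra_simps)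
    then have "\<bar>real n * (S (t * e) - t * S e)\<bar> \<le> B + \<bar>S e\<bar>"
      using 1 2 by linarith
    then show ?thesis
      by (simp add: abs_mult)
  qed
  then have "S (t * e) - t * S e = 0"
    by (rule eq_zero_if_multiples_bounded)
  then show ?thesis by simp
qed

theorem theorem1:
  fixes S :: "real \<Rightarrow> real"
  assumes "sublinear_fun S"
    and "locally_bounded_fun S"
  shows "linear_fun_on {0..} S \<and> linear_fun_on {..0} S"
proof
  have "S x = S 1 * x" if "x \<ge> 0" for x
    using sublinear_fun_pos_homogeneous[OF assms, of 1 x] that by simp
  then show "linear_fun_on {0..} S"
    unfolding linear_fun_on_def by blast
  \<comment> \<open>Here x = (-x) * (-1) with -x \<ge> 0, which puts the minus sign into the
    slope.\<close>
  have "S x = - S (- 1) * x" if "x \<le> 0" for x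
    using sublinear_fun_pos_homogeneous[OF assms, of "- 1" "- x"] that by simp
  then show "linear_fun_on {..0} S"
    unfolding linear_fun_on_def by blast
qed

end
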